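(* Let $\boldsymbol M$ be a $(d\times r)$ mixture model with coefficient matrix $A=(a_{jk})$, signatures $J_k$, stable tail dependence function $\ell$ and factor stable tail dependence functions $\ell^{(k)}_{J_k}$, and let $\boldsymbol U$ be the mixture generator built from $A$, generators $\boldsymbol U^{(1)},\dots,\boldsymbol U^{(r)}$ and mass vector $\boldsymbol m$ (see context). The random vector $\boldsymbol T$ with distribution $\mathsf P[\boldsymbol T\in B]=\mathsf E[\mathbb 1\{\boldsymbol U\in B\}e^{\max(\boldsymbol U)}]/\mathsf E[e^{\max(\boldsymbol U)}]$ satisfies $$\mathsf P[\boldsymbol T\in\cdot\,]=\sum_{k\in R}w_k\,\mathsf P\big[\boldsymbol T^{(k)}\in\pi_{J_k}(\mathbb A_{J_k}\cap\cdot\,)\big],$$ where the distribution of the $|J_k|$-dimensional random vector $\boldsymbol T^{(k)}$ and the weight $w_k$ are $$\mathsf P[\boldsymbol T^{(k)}\in\cdot\,]=\frac{\mathsf E[\exp\{\max\boldsymbol P^{(k)}\}\mathbb 1\{\boldsymbol P^{(k)}\in\cdot\,\}]}{\mathsf E[\exp\{\max\boldsymbol P^{(k)}\}]},\qquad w_k=\frac{\ell^{(k)}_{J_k}((a_{jk})_{j\in J_k})}{\ell(\boldsymbol 1)},$$ with $\boldsymbol P^{(k)}=\boldsymbol U^{(k)}+(\ln(a_{jk}/m_k))_{j\in J_k}$. Moreover, if $\boldsymbol U^{(k)}$ has density $f_{\boldsymbol U^{(k)}}$ with respect to $\lambda_{|J_k|}$, then $\boldsymbol T^{(k)}$ has density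 $$f_{\boldsymbol T^{(k)}}(\boldsymbol t)=c^{(k)}\,g_k(\boldsymbol t)\sum_{j\in J_k}n_{j,k}\,q_{j,k}(\boldsymbol t),\qquad\boldsymbol t\in\mathbb R^{J_k},$$ with $g_k(\boldsymbol t)=e^{\max(\boldsymbol t)}/\sum_{j\in J_k}e^{t_j}$, $c^{(k)}=\sum_{j\in J_k}a_{jk}/\ell^{(k)}_{J_k}((a_{jk})_{j\in J_k})$, and, for $j\in J_k$, $$n_{j,k}=\frac{a_{jk}}{\sum_{i\in J_k}a_{ik}},\qquad q_{j,k}(\boldsymbol t)=\frac{e^{t_j}f_{\boldsymbol U^{(k)}}\big(\boldsymbol t-(\ln(a_{ik}/m_k))_{i\in J_k}\big)}{a_{jk}/m_k}.$$
   Context: $D=\{1,\dots,d\}$, $R=\{1,\dots,r\}$, $\mathbb E=[0,\infty)^d\setminus\{\boldsymbol 0\}$; $\lambda_m$ is $m$-dimensional Lebesgue measure; $e^{-\infty}=0$. For non-empty $J\subseteq D$, $\mathbb A_J=\{\boldsymbol x\in[-\infty,\infty)^d:x_j>-\infty\text{ iff }j\in J\}$ and $\pi_J:\mathbb A_J\to\mathbb R^J$, $\boldsymbol x\mapsto(x_j)_{j\in J}$. For a multivariate extreme-value (mev) distribution $G^*$ with unit-Fréchet margins, the exponent measure $\mu$ is the Borel measure on $\mathbb E$ with $G^*(\boldsymbol x)=\exp\{-\mu(\mathbb E\setminus[\boldsymbol 0,\boldsymbol x])\}$; the stable tail dependence function (stdf) is $\ell(\boldsymbol x)=-\ln G^*(1/\boldsymbol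 x)$; a non-empty $J\subseteq D$ is an extreme direction if $\mu(\{\boldsymbol x\in\mathbb E:x_j>0\text{ iff }j\in J\})>0$. Mixture model: $\boldsymbol Z^{(1)},\ldots,\boldsymbol Z^{(r)}$ are independent random vectors in $\mathbb R^d$, each with an mev distribution with unit-Fréchet margins, stdf $\ell^{(k)}$ and single extreme direction $D$; $A=(a_{jk})\in[0,1]^{d\times r}$ has unit row sums and positive column sums; $\boldsymbol M=(\max_{k\in R}\{a_{jk}Z_j^{(k)}\})_{j\in D}$. Put $J_k=\{j\in D:a_{jk}>0\}$ and let $\ell^{(k)}_{J_k}(\boldsymbol x_{J_k})=\ell^{(k)}(\sum_{j\in J_k}x_j\boldsymbol e_j)$, $\boldsymbol x_{J_k}\in[0,\infty)^{J_k}$, be the stdf of $\boldsymbol Z^{(k)}_{J_k}$. The stdf of $\boldsymbol M$ is $\ell(\boldsymbol x)=\sum_{k\in R}\ell^{(k)}_{J_k}((a_{jk}x_j)_{j\in J_k})$. Generators: for each $k$, $\boldsymbol U^{(k)}$ is a random vector in $\mathbb R^{J_k}$ with $\mathsf E[e^{U^{(k)}_j}]=1$ for $j\in J_k$ and $\mathsf E[\max_{j\in J_k}\{x_je^{U_j^{(k)}}\}]=\ell^{(k)}_{J_k}(\boldsymbol x_{J_k})$ for all $\boldsymbol x_{J_k}\in[0,\infty)^{J_k}$. The mass vector $\boldsymbol m\in(0,1)^r$ satisfies $\sum_k m_k=1$. The mixture generator $\boldsymbol U$ is the random vector in $[-\infty,\infty)^d$ with $$\mathsf P[\boldsymbol U\in\cdot\,]=\sum_{k\in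 R}m_k\,\mathsf P\big[\boldsymbol U^{(k)}+(\ln(a_{jk}/m_k))_{j\in J_k}\in\pi_{J_k}(\mathbb A_{J_k}\cap\cdot\,)\big].$$ *)

theory Defs
  imports "HOL-Probability.Probability"
begin

(* Vectors with coordinates in a finite index set J are the extensional functions on J,
   so R^J is the space of PiM J (%_. borel); D = {1..d} and R = {1..r}. *)

abbreviation real_vec :: "nat set \<Rightarrow> (nat \<Rightarrow> real) measure" where
  "real_vec J \<equiv> PiM J (\<lambda>_. borel)"

abbreviation lebesgue_vec :: "nat set \<Rightarrow> (nat \<Rightarrow> real) measure" where
  "lebesgue_vec J \<equiv> PiM J (\<lambda>_. lborel)"

(* [-\<infinity>,\<infinity>)^D with its Borel sigma-algebra *)
abbreviation ext_vec :: "nat set \<Rightarrow> (nat \<Rightarrow> ereal) measure" where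
  "ext_vec D \<equiv> PiM D (\<lambda>_. restrict_space borel {..<\<infinity>})"

(* Only used for arguments below \<infinity>; the value at \<infinity> is meaningless. *)
definition exp_ext :: "ereal \<Rightarrow> real" where
  "exp_ext x = (if x = -\<infinity> then 0 else exp (real_of_ereal x))"

(* Distribution function; extended arguments, because the stdf evaluates it at 1/0 = \<infinity>. *)
definition joint_cdf :: "nat set \<Rightarrow> (nat \<Rightarrow> real) measure \<Rightarrow> (nat \<Rightarrow> ereal) \<Rightarrow> real" where
  "joint_cdf D \<nu> x = measure \<nu> {z \<in> space \<nu>. \<forall>j\<in>D. ereal (z j) \<le> x j}"

(* Non-degenerate weak limit of componentwise maxima of iid vectors with law F, after
   componentwise affine normalisation. As a function of x, the distribution function only
   depends on the coordinates in D, so its continuity at x for the product topology on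
   nat \<Rightarrow> real is continuity on R^D. *)
definition mev :: "nat set \<Rightarrow> (nat \<Rightarrow> real) measure \<Rightarrow> bool" where
  "mev D \<nu> \<longleftrightarrow>
     prob_space \<nu> \<and> sets \<nu> = sets (real_vec D) \<and>
     (\<forall>j\<in>D. \<nexists>c. measure \<nu> {z \<in> space \<nu>. z j = c} = 1) \<and>
     (\<exists>F (a :: nat \<Rightarrow> nat \<Rightarrow> real) b.
        prob_space F \<and> sets F = sets (real_vec D) \<and> (\<forall>n. \<forall>j\<in>D. 0 < a n j) \<and>
        (\<forall>x :: nat \<Rightarrow> real. isCont (\<lambda>y. joint_cdf D \<nu> (\<lambda>j. ereal (y j))) x \<longrightarrow>
           (\<lambda>n. joint_cdf D F (\<lambda>j. ereal (a n j * x j + b n j)) ^ n)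
             \<longlonglongrightarrow> joint_cdf D \<nu> (\<lambda>j. ereal (x j))))"

definition unit_frechet_margins :: "nat set \<Rightarrow> (nat \<Rightarrow> real) measure \<Rightarrow> bool" where
  "unit_frechet_margins D \<nu> \<longleftrightarrow>
     (\<forall>j\<in>D. \<forall>x>0. measure \<nu> {z \<in> space \<nu>. z j \<le> x} = exp (- (1 / x)))"

definition stdf :: "nat set \<Rightarrow> (nat \<Rightarrow> real) measure \<Rightarrow> (nat \<Rightarrow> real) \<Rightarrow> real" where
  "stdf D \<nu> x = - ln (joint_cdf D \<nu> (\<lambda>j. 1 / ereal (x j)))"

definition punctured_orthant :: "nat set \<Rightarrow> (nat \<Rightarrow> real) set" where
  "punctured_orthant D = (D \<rightarrow>\<^sub>E {0..}) - {\<lambda>j\<in>D. 0}"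

definition exponent_measure ::
    "nat set \<Rightarrow> (nat \<Rightarrow> real) measure \<Rightarrow> (nat \<Rightarrow> real) measure \<Rightarrow> bool" where
  "exponent_measure D \<nu> \<mu> \<longleftrightarrow>
     sets \<mu> = sets (restrict_space (real_vec D) (punctured_orthant D)) \<and>
     (\<forall>x \<in> D \<rightarrow>\<^sub>E {0..}.
        joint_cdf D \<nu> (\<lambda>j. ereal (x j)) =
          exp_ext (- enn2ereal (emeasure \<mu> (punctured_orthant D - (\<Pi>\<^sub>E j\<in>D. {0..x j})))))"

(* For an mev law with unit-Frechet margins the exponent measure exists and is unique,
   so the existential quantifier just names it. *)
definition extreme_directions :: "nat set \<Rightarrow> (nat \<Rightarrow> real) measure \<Rightarrow> nat set set" where
  "extreme_directions D \<nu> =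
     {J. J \<noteq> {} \<and> J \<subseteq> D \<and>
        (\<exists>\<mu>. exponent_measure D \<nu> \<mu> \<and>
             emeasure \<mu> {x \<in> punctured_orthant D. \<forall>j\<in>D. 0 < x j \<longleftrightarrow> j \<in> J} > 0)}"

definition signature :: "nat \<Rightarrow> (nat \<Rightarrow> nat \<Rightarrow> real) \<Rightarrow> nat \<Rightarrow> nat set" where
  "signature d A k = {j \<in> {1..d}. 0 < A j k}"

definition mixture_model ::
    "'a measure \<Rightarrow> nat \<Rightarrow> nat \<Rightarrow> (nat \<Rightarrow> nat \<Rightarrow> real) \<Rightarrow> (nat \<Rightarrow> 'a \<Rightarrow> nat \<Rightarrow> real) \<Rightarrow> bool" where
  "mixture_model P d r A Z \<longleftrightarrow>
     prob_space.indep_vars P (\<lambda>_. real_vec {1..d}) Z {1..r} \<and>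
     (\<forall>k\<in>{1..r}. mev {1..d} (distr P (real_vec {1..d}) (Z k)) \<and>
        unit_frechet_margins {1..d} (distr P (real_vec {1..d}) (Z k)) \<and>
        extreme_directions {1..d} (distr P (real_vec {1..d}) (Z k)) = {{1..d}}) \<and>
     (\<forall>j\<in>{1..d}. \<forall>k\<in>{1..r}. A j k \<in> {0..1}) \<and>
     (\<forall>j\<in>{1..d}. (\<Sum>k\<in>{1..r}. A j k) = 1) \<and>
     (\<forall>k\<in>{1..r}. 0 < (\<Sum>j\<in>{1..d}. A j k))"

definition mixture_vector ::
    "nat \<Rightarrow> nat \<Rightarrow> (nat \<Rightarrow> nat \<Rightarrow> real) \<Rightarrow> (nat \<Rightarrow> 'a \<Rightarrow> nat \<Rightarrow> real) \<Rightarrow> 'a \<Rightarrow> nat \<Rightarrow> real" where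
  "mixture_vector d r A Z \<omega> = (\<lambda>j\<in>{1..d}. Max ((\<lambda>k. A j k * Z k \<omega> j) ` {1..r}))"

definition mixture_stdf ::
    "'a measure \<Rightarrow> nat \<Rightarrow> nat \<Rightarrow> (nat \<Rightarrow> nat \<Rightarrow> real) \<Rightarrow> (nat \<Rightarrow> 'a \<Rightarrow> nat \<Rightarrow> real)
      \<Rightarrow> (nat \<Rightarrow> real) \<Rightarrow> real" where
  "mixture_stdf P d r A Z =
     stdf {1..d} (distr P (real_vec {1..d}) (mixture_vector d r A Z))"

definition factor_stdf ::
    "'a measure \<Rightarrow> nat \<Rightarrow> (nat \<Rightarrow> nat \<Rightarrow> real) \<Rightarrow> (nat \<Rightarrow> 'a \<Rightarrow> nat \<Rightarrow> real) \<Rightarrow> nat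
      \<Rightarrow> (nat \<Rightarrow> real) \<Rightarrow> real" where
  "factor_stdf P d A Z k x =
     stdf {1..d} (distr P (real_vec {1..d}) (Z k))
       (\<lambda>j\<in>{1..d}. if j \<in> signature d A k then x j else 0)"

(* V generates the stdf l on [0,\<infinity>)^J. The first expectation being 1, rather than
   the default 0, forces integrability of all the functions involved. *)
definition generator ::
    "'a measure \<Rightarrow> nat set \<Rightarrow> ((nat \<Rightarrow> real) \<Rightarrow> real) \<Rightarrow> ('a \<Rightarrow> nat \<Rightarrow> real) \<Rightarrow> bool" where
  "generator P J l V \<longleftrightarrow>
     V \<in> measurable P (real_vec J) \<and>
     (\<forall>j\<in>J. (\<integral>\<omega>. exp (V \<omega> j) \<partial>P) = 1) \<and>
     (\<forall>x \<in> J \<rightarrow>\<^sub>E {0..}. (\<integral>\<omega>. Max ((\<lambda>j. x j * exp (V \<omega> j)) ` J) \<partial>P) = l x)"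

definition mass_vector :: "nat \<Rightarrow> (nat \<Rightarrow> real) \<Rightarrow> bool" where
  "mass_vector r m \<longleftrightarrow> (\<forall>k\<in>{1..r}. m k \<in> {0<..<1}) \<and> (\<Sum>k\<in>{1..r}. m k) = 1"

definition face :: "nat set \<Rightarrow> nat set \<Rightarrow> (nat \<Rightarrow> ereal) set" where
  "face D J = {x \<in> D \<rightarrow>\<^sub>E {..<\<infinity>}. \<forall>j\<in>D. -\<infinity> < x j \<longleftrightarrow> j \<in> J}"

definition face_proj :: "nat set \<Rightarrow> (nat \<Rightarrow> ereal) \<Rightarrow> nat \<Rightarrow> real" where
  "face_proj J x = (\<lambda>j\<in>J. real_of_ereal (x j))"

definition log_shift ::
    "nat \<Rightarrow> (nat \<Rightarrow> nat \<Rightarrow> real) \<Rightarrow> (nat \<Rightarrow> real) \<Rightarrow> nat \<Rightarrow> nat \<Rightarrow> real" where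
  "log_shift d A m k = (\<lambda>j\<in>signature d A k. ln (A j k / m k))"

definition shifted_generator ::
    "nat \<Rightarrow> (nat \<Rightarrow> nat \<Rightarrow> real) \<Rightarrow> (nat \<Rightarrow> real) \<Rightarrow> (nat \<Rightarrow> 'a \<Rightarrow> nat \<Rightarrow> real)
      \<Rightarrow> nat \<Rightarrow> 'a \<Rightarrow> nat \<Rightarrow> real" where
  "shifted_generator d A m V k \<omega> = (\<lambda>j\<in>signature d A k. V k \<omega> j + log_shift d A m k j)"

definition mixture_generator ::
    "'a measure \<Rightarrow> nat \<Rightarrow> nat \<Rightarrow> (nat \<Rightarrow> nat \<Rightarrow> real) \<Rightarrow> (nat \<Rightarrow> real)
      \<Rightarrow> (nat \<Rightarrow> 'a \<Rightarrow> nat \<Rightarrow> real) \<Rightarrow> ('a \<Rightarrow> nat \<Rightarrow> ereal) \<Rightarrow> bool" where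
  "mixture_generator P d r A m V U \<longleftrightarrow>
     U \<in> measurable P (ext_vec {1..d}) \<and>
     (\<forall>B \<in> sets (ext_vec {1..d}).
        measure P {\<omega> \<in> space P. U \<omega> \<in> B} =
          (\<Sum>k\<in>{1..r}. m k * measure P {\<omega> \<in> space P. shifted_generator d A m V k \<omega>
             \<in> face_proj (signature d A k) ` (face {1..d} (signature d A k) \<inter> B)}))"

definition exp_max :: "nat set \<Rightarrow> (nat \<Rightarrow> real) \<Rightarrow> real" where
  "exp_max J x = exp (Max (x ` J))"

definition exp_max_ext :: "nat set \<Rightarrow> (nat \<Rightarrow> ereal) \<Rightarrow> real" where
  "exp_max_ext D u = exp_ext (Max (u ` D))"

(* The law of X tilted by h is well defined iff this holds. *)
definition tiltable :: "'a measure \<Rightarrow> ('v \<Rightarrow> real) \<Rightarrow> ('a \<Rightarrow> 'v) \<Rightarrow> bool" where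
  "tiltable P h X \<longleftrightarrow> integrable P (\<lambda>\<omega>. h (X \<omega>)) \<and> 0 < (\<integral>\<omega>. h (X \<omega>) \<partial>P)"

(* T, a random vector on Q with values in N, has the law of X on P tilted by h. *)
definition tilted_vector ::
    "'a measure \<Rightarrow> ('v \<Rightarrow> real) \<Rightarrow> ('a \<Rightarrow> 'v) \<Rightarrow> 'v measure \<Rightarrow> 'b measure \<Rightarrow> ('b \<Rightarrow> 'v) \<Rightarrow> bool" where
  "tilted_vector P h X N Q T \<longleftrightarrow>
     T \<in> measurable Q N \<and>
     (\<forall>B \<in> sets N. measure Q {\<omega> \<in> space Q. T \<omega> \<in> B} =
        (\<integral>\<omega>. indicator B (X \<omega>) * h (X \<omega>) \<partial>P) / (\<integral>\<omega>. h (X \<omega>) \<partial>P))"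

end

theory Submission
  imports Defs
begin

text \<open>
  The law of the mixture generator is the mixture, with weights m k, of the laws of the
  shifted generators placed on the faces of the extended space; tilting acts on each component
  separately and rescales its weight by its total tilted mass. The generator property identifies
  that mass, times m k, with the k-th factor stdf at the k-th column of A, and by independence
  of the factors these values add up to the stdf of the mixture at the vector of ones.
  For the densities, multiplication by the sum of the exponentials cancels the denominator
  of g k, leaving the tilt of a translate of f.
\<close>

section \<open>Embedding the real space over \<open>J\<close> as a face of the extended
  space\<close>

text \<open>For \<open>J \<subseteq> D\<close> this is the inverse of \<open>face_proj J\<close> on
  \<open>face D J\<close>. It is measurable, so preimages under it can replace images under
  \<open>face_proj J\<close>.\<close>

definition ext_embed :: "nat set \<Rightarrow> nat set \<Rightarrow> (nat \<Rightarrow> real) \<Rightarrow> nat \<Rightarrow> ereal" where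
  "ext_embed D J x = (\<lambda>j\<in>D. if j \<in> J then ereal (x j) else -\<infinity>)"

lemma ext_embed_face_proj:
  assumes "x \<in> face D J"
  shows "ext_embed D J (face_proj J x) = x"
proof
  fix j
  show "ext_embed D J (face_proj J x) j = x j"
  proof (cases "j \<in> D")
    case True
    then have "x j < \<infinity>" "-\<infinity> < x j \<longleftrightarrow> j \<in> J"
      using assms by (auto simp: face_def PiE_iff)
    with True show ?thesis
      by (cases "x j") (auto simp: ext_embed_def face_proj_def)
  next
    case False
    then show ?thesis
      using assms by (auto simp: face_def ext_embed_def PiE_iff extensional_def)
  qed
qed

text \<open>On the face, \<open>face_proj J\<close> is a bijection inverted by
  \<open>ext_embed D J\<close>, so its images are preimages. This makes the sets in the mixture
  formula measurable and turns each component into the law of an embedded vector.\<close>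

lemma face_proj_image:
  assumes "J \<subseteq> D"
  shows "face_proj J ` (face D J \<inter> B) = {x \<in> J \<rightarrow>\<^sub>E UNIV. ext_embed D J x \<in> B}"
proof (intro equalityI subsetI)
  fix y assume "y \<in> face_proj J ` (face D J \<inter> B)"
  then show "y \<in> {x \<in> J \<rightarrow>\<^sub>E UNIV. ext_embed D J x \<in> B}"
    by (auto simp: ext_embed_face_proj) (auto simp: face_proj_def)
next
  fix x assume x: "x \<in> {x \<in> J \<rightarrow>\<^sub>E UNIV. ext_embed D J x \<in> B}"
  then have "face_proj J (ext_embed D J x) = x"
    using assms by (auto simp: face_proj_def ext_embed_def PiE_iff extensional_def fun_eq_iff)
  moreover have "ext_embed D J x \<in> face D J"
    using assms by (auto simp: face_def ext_embed_def)
  ultimately show "x \<in> face_proj J ` (face D J \<inter> B)"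
    using x by (intro image_eqI[of x _ "ext_embed D J x"]) auto
qed

lemma measurable_ext_embed: "ext_embed D J \<in> measurable (real_vec J) (ext_vec D)"
  unfolding ext_embed_def
proof (intro measurable_restrict measurable_restrict_space2)
  fix j assume "j \<in> D"
  show "(\<lambda>x. if j \<in> J then ereal (x j) else -\<infinity>) \<in> borel_measurable (real_vec J)"
    by (cases "j \<in> J") auto
qed auto

section \<open>Exponentials of maxima\<close>

lemma measurable_exp_max_ext:
  assumes "finite D"
  shows "exp_max_ext D \<in> borel_measurable (ext_vec D)"
proof -
  have "(\<lambda>u. u j) \<in> borel_measurable (ext_vec D)" if "j \<in> D" for j
    using measurable_component_singleton[OF that, of "\<lambda>_. restrict_space borel {..<\<infinity>::ereal}"]
    by (rule measurable_restrict_space2_iff[THEN iffD1, THEN conjunct1])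
  then have Max: "(\<lambda>u. Max ((\<lambda>j. u j) ` D)) \<in> borel_measurable (ext_vec D)"
    by (intro borel_measurable_Max assms) auto
  have "exp_ext \<in> borel_measurable borel"
    unfolding exp_ext_def by measurable
  from measurable_compose[OF Max this] show ?thesis
    by (simp add: exp_max_ext_def[abs_def])
qed

lemma exp_Max:
  fixes f :: "'a \<Rightarrow> real"
  assumes "finite J" "J \<noteq> {}"
  shows "exp (Max (f ` J)) = Max ((\<lambda>j. exp (f j)) ` J)"
  using mono_Max_commute[of exp "f ` J"] assms by (simp add: mono_def image_image)

lemma measurable_exp_max:
  assumes "finite J"
  shows "exp_max J \<in> borel_measurable (real_vec J)"
proof -
  have "(\<lambda>x. Max ((\<lambda>j. x j) ` J)) \<in> borel_measurable (real_vec J)"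
    by (intro borel_measurable_Max assms) auto
  then show ?thesis
    unfolding exp_max_def[abs_def] by measurable
qed

lemma exp_max_nonneg: "0 \<le> exp_max J x"
  by (simp add: exp_max_def)

text \<open>Coordinates outside \<open>J\<close> are \<open>-\<infinity>\<close> and cannot exceed
  those in the non-empty set \<open>J\<close>. The tilting weight is therefore the same before and
  after the embedding.\<close>

lemma exp_max_ext_embed:
  assumes "finite D" "J \<subseteq> D" "J \<noteq> {}"
  shows "exp_max_ext D (ext_embed D J x) = exp_max J x"
proof -
  have finJ: "finite J" using assms finite_subset by blast
  have "Max (ext_embed D J x ` D) = ereal (Max (x ` J))"
  proof (rule Max_eqI)
    have "Max (x ` J) \<in> x ` J" using finJ assms by (intro Max_in) auto
    then show "ereal (Max (x ` J)) \<in> ext_embed D J x ` D"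
      using assms by (force simp: ext_embed_def)
    show "y \<le> ereal (Max (x ` J))" if "y \<in> ext_embed D J x ` D" for y
      using that finJ by (auto simp: ext_embed_def split: if_splits)
  qed (use assms in auto)
  then show ?thesis by (simp add: exp_max_ext_def exp_max_def exp_ext_def)
qed

section \<open>Integrals against a mixture of laws\<close>

text \<open>Both sides are additive, homogeneous and continuous along increasing sequences in
  \<open>h\<close>, so the identity that \<open>law\<close> gives for indicators extends to all
  nonnegative measurable functions.\<close>

lemma nn_integral_mixture:
  assumes U: "U \<in> measurable P N" and Y: "\<And>k. k \<in> K \<Longrightarrow> Y k \<in> measurable P N"
    and law: "\<And>B. B \<in> sets N \<Longrightarrow>
      emeasure (distr P N U) B = (\<Sum>k\<in>K. ennreal (m k) * emeasure (distr P N (Y k)) B)"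
    and h: "h \<in> borel_measurable N"
  shows "(\<integral>\<^sup>+\<omega>. h (U \<omega>) \<partial>P) = (\<Sum>k\<in>K. ennreal (m k) * (\<integral>\<^sup>+\<omega>. h (Y k \<omega>) \<partial>P))"
proof -
  have "(\<integral>\<^sup>+x. h x \<partial>distr P N U) = (\<Sum>k\<in>K. ennreal (m k) * (\<integral>\<^sup>+x. h x \<partial>distr P N (Y k)))"
    using h
  proof (induction rule: borel_measurable_induct)
    case (cong f g)
    have "nn_integral (distr P N X) f = nn_integral (distr P N X) g" for X
      by (rule nn_integral_cong) (use cong in auto)
    with cong.IH show ?case by simp
  next
    case (set B)
    then show ?case by (simp add: law)
  next
    case (mult u c)
    then show ?case by (simp add: nn_integral_cmult sum_distrib_left mult.left_commute)
  next
    case (add u v)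
    then show ?case by (simp add: nn_integral_add sum.distrib distrib_left)
  next
    case (seq F)
    have *: "nn_integral (distr P N X) (Sup (range F)) = (SUP i. nn_integral (distr P N X) (F i))" for X
      using nn_integral_monotone_convergence_SUP[of F "distr P N X"] seq
      by (simp add: image_comp SUP_apply[abs_def])
    \<comment> \<open>Monotonicity of every summand is what lets the supremum pass through the
      sum.\<close>
    have mono: "incseq (\<lambda>i. ennreal (m k) * nn_integral (distr P N (Y k)) (F i))" for k
      using seq by (auto simp: incseq_def le_fun_def intro!: mult_left_mono nn_integral_mono)
    have "nn_integral (distr P N U) (Sup (range F))
        = (SUP i. \<Sum>k\<in>K. ennreal (m k) * nn_integral (distr P N (Y k)) (F i))"
      unfolding * by (simp add: seq)
    also have "\<dots> = (\<Sum>k\<in>K. SUP i. ennreal (m k) * nn_integral (distr P N (Y k)) (F i))"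
      by (rule ennreal_SUP_sum) (rule mono)
    also have "\<dots> = (\<Sum>k\<in>K. ennreal (m k) * nn_integral (distr P N (Y k)) (Sup (range F)))"
      unfolding * by (simp add: SUP_mult_left_ennreal)
    finally show ?case .
  qed
  then show ?thesis
    using U Y h by (simp add: nn_integral_distr cong: sum.cong)
qed

text \<open>For nonnegative \<open>h\<close> the extended integral is a sum of finite terms, which
  gives integrability together with the value.\<close>

lemma integral_mixture:
  assumes U: "U \<in> measurable P N" and Y: "\<And>k. k \<in> K \<Longrightarrow> Y k \<in> measurable P N"
    and law: "\<And>B. B \<in> sets N \<Longrightarrow>
      emeasure (distr P N U) B = (\<Sum>k\<in>K. ennreal (m k) * emeasure (distr P N (Y k)) B)"
    and h: "h \<in> borel_measurable N" and nonneg: "\<And>x. 0 \<le> h x"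
    and m: "\<And>k. k \<in> K \<Longrightarrow> 0 \<le> m k"
    and int: "\<And>k. k \<in> K \<Longrightarrow> integrable P (\<lambda>\<omega>. h (Y k \<omega>))"
  shows "integrable P (\<lambda>\<omega>. h (U \<omega>))"
    and "(\<integral>\<omega>. h (U \<omega>) \<partial>P) = (\<Sum>k\<in>K. m k * (\<integral>\<omega>. h (Y k \<omega>) \<partial>P))"
proof -
  have "(\<integral>\<^sup>+\<omega>. ennreal (h (U \<omega>)) \<partial>P) = (\<Sum>k\<in>K. ennreal (m k) * (\<integral>\<^sup>+\<omega>. ennreal (h (Y k \<omega>)) \<partial>P))"
    using nn_integral_mixture[OF U Y law, of "\<lambda>x. ennreal (h x)"] h by simp
  also have "\<dots> = (\<Sum>k\<in>K. ennreal (m k * (\<integral>\<omega>. h (Y k \<omega>) \<partial>P)))"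
    using int nonneg m by (intro sum.cong) (simp_all add: nn_integral_eq_integral ennreal_mult)
  also have "\<dots> = ennreal (\<Sum>k\<in>K. m k * (\<integral>\<omega>. h (Y k \<omega>) \<partial>P))"
    using nonneg m by (intro sum_ennreal) simp
  finally have *: "(\<integral>\<^sup>+\<omega>. ennreal (h (U \<omega>)) \<partial>P) = ennreal (\<Sum>k\<in>K. m k * (\<integral>\<omega>. h (Y k \<omega>) \<partial>P))" .
  have meas: "(\<lambda>\<omega>. h (U \<omega>)) \<in> borel_measurable P"
    using U h by measurable
  show "integrable P (\<lambda>\<omega>. h (U \<omega>))"
    by (rule integrableI_nonneg[OF meas]) (use nonneg * in auto)
  show "(\<integral>\<omega>. h (U \<omega>) \<partial>P) = (\<Sum>k\<in>K. m k * (\<integral>\<omega>. h (Y k \<omega>) \<partial>P))"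
    by (simp add: integral_eq_nn_integral meas nonneg * m sum_nonneg)
qed

section \<open>Translations of Lebesgue measure and densities of tilted vectors\<close>

text \<open>The product measure is determined by its values on boxes. The preimage of a box under a
  translation is a box, so translation invariance of \<open>lborel\<close> in each coordinate
  suffices.\<close>

lemma distr_lebesgue_vec_plus:
  assumes "finite J"
  shows "distr (lebesgue_vec J) (lebesgue_vec J) (\<lambda>x. \<lambda>j\<in>J. x j + s j) = lebesgue_vec J"
proof -
  interpret product_sigma_finite "\<lambda>_::nat. lborel :: real measure" ..
  have meas: "(\<lambda>x. \<lambda>j\<in>J. x j + s j) \<in> measurable (lebesgue_vec J) (lebesgue_vec J)"
    by measurable
  show ?thesis
  proof (rule PiM_eqI[OF assms])
    fix B :: "nat \<Rightarrow> real set" assume B: "\<And>i. i \<in> J \<Longrightarrow> B i \<in> sets lborel"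
    have shift: "emeasure lborel {x. x + s i \<in> B i} = emeasure lborel (B i)"
      and shift_sets: "{x. x + s i \<in> B i} \<in> sets lborel" if "i \<in> J" for i
    proof -
      have eq: "{x. x + s i \<in> B i} = (\<lambda>x. s i + x) -` B i" by (auto simp: add.commute)
      show "{x. x + s i \<in> B i} \<in> sets lborel"
        using measurable_sets[of "\<lambda>x. s i + x" borel borel "B i"] B[OF that] by (simp add: eq)
      show "emeasure lborel {x. x + s i \<in> B i} = emeasure lborel (B i)"
        using B[OF that] emeasure_distr[of "\<lambda>x. s i + x" lborel borel "B i"]
        by (simp add: eq lborel_distr_plus)
    qed
    have "emeasure (distr (lebesgue_vec J) (lebesgue_vec J) (\<lambda>x. \<lambda>j\<in>J. x j + s j)) (Pi\<^sub>E J B)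
        = emeasure (lebesgue_vec J) ((\<lambda>x. \<lambda>j\<in>J. x j + s j) -` Pi\<^sub>E J B \<inter> space (lebesgue_vec J))"
      using B by (intro emeasure_distr meas sets_PiM_I_finite assms) auto
    also have "(\<lambda>x. \<lambda>j\<in>J. x j + s j) -` Pi\<^sub>E J B \<inter> space (lebesgue_vec J) = (\<Pi>\<^sub>E i\<in>J. {x. x + s i \<in> B i})"
      by (auto simp: space_PiM PiE_iff)
    also have "emeasure (lebesgue_vec J) \<dots> = (\<Prod>i\<in>J. emeasure lborel (B i))"
      using shift_sets by (simp add: emeasure_PiM assms shift)
    finally show "emeasure (distr (lebesgue_vec J) (lebesgue_vec J) (\<lambda>x. \<lambda>j\<in>J. x j + s j)) (Pi\<^sub>E J B)
      = (\<Prod>i\<in>J. emeasure lborel (B i))" .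
  qed simp
qed

lemma nn_integral_lebesgue_vec_shift:
  assumes J: "finite J" and h: "h \<in> borel_measurable (real_vec J)"
    and f: "f \<in> borel_measurable (lebesgue_vec J)"
  shows "(\<integral>\<^sup>+x. f x * h (\<lambda>j\<in>J. x j + s j) \<partial>lebesgue_vec J)
    = (\<integral>\<^sup>+t. f (\<lambda>j\<in>J. t j - s j) * h t \<partial>lebesgue_vec J)"
proof -
  \<comment> \<open>\<open>lborel\<close> and \<open>borel\<close> have the same sets, so
    measurability of \<open>h\<close> carries over to the Lebesgue product.\<close>
  have sets_eq [measurable_cong]: "sets (lebesgue_vec J) = sets (real_vec J)"
    by (rule sets_PiM_cong) auto
  note f[measurable] h[measurable]
  have plus: "(\<lambda>x. \<lambda>j\<in>J. x j + s j) \<in> measurable (lebesgue_vec J) (lebesgue_vec J)"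
    by measurable
  have minus: "(\<lambda>t. \<lambda>j\<in>J. t j - s j) \<in> measurable (lebesgue_vec J) (lebesgue_vec J)"
    by measurable
  have h': "h \<in> borel_measurable (lebesgue_vec J)" by measurable
  have F: "(\<lambda>t. f (\<lambda>j\<in>J. t j - s j) * h t) \<in> borel_measurable (lebesgue_vec J)"
    using measurable_compose[OF minus f] h' by simp
  have "(\<integral>\<^sup>+t. f (\<lambda>j\<in>J. t j - s j) * h t \<partial>lebesgue_vec J)
      = (\<integral>\<^sup>+t. f (\<lambda>j\<in>J. t j - s j) * h t
          \<partial>distr (lebesgue_vec J) (lebesgue_vec J) (\<lambda>x. \<lambda>j\<in>J. x j + s j))"
    by (simp add: distr_lebesgue_vec_plus[OF J])
  also have "\<dots> = (\<integral>\<^sup>+x. f (\<lambda>j\<in>J. (\<lambda>j\<in>J. x j + s j) j - s j) * h (\<lambda>j\<in>J. x j + s j) \<partial>lebesgue_vec J)"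
    by (rule nn_integral_distr[OF plus]) (use F in simp)
  also have "\<dots> = (\<integral>\<^sup>+x. f x * h (\<lambda>j\<in>J. x j + s j) \<partial>lebesgue_vec J)"
  proof (rule nn_integral_cong)
    fix x :: "nat \<Rightarrow> real" assume "x \<in> space (lebesgue_vec J)"
    \<comment> \<open>Since \<open>x\<close> is extensional, translating by \<open>s\<close> and
      back also restores it outside \<open>J\<close>.\<close>
    then have "(\<lambda>j\<in>J. (\<lambda>j\<in>J. x j + s j) j - s j) = x"
      by (auto simp: space_PiM PiE_iff extensional_def fun_eq_iff)
    then show "f (\<lambda>j\<in>J. (\<lambda>j\<in>J. x j + s j) j - s j) * h (\<lambda>j\<in>J. x j + s j)
        = f x * h (\<lambda>j\<in>J. x j + s j)" by simp
  qed
  finally show ?thesis ..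
qed

text \<open>The tilted probability of a set is an integral against the density \<open>f\<close> of
  \<open>V\<close>. Substituting \<open>t = x + s\<close> moves the shift from \<open>h\<close> and
  the indicator to \<open>f\<close>, and the integrand that remains is the density.\<close>

lemma distributed_tilted:
  assumes Q: "prob_space Q" and J: "finite J"
    and dens: "distributed P (lebesgue_vec J) V (\<lambda>t. ennreal (f t))"
    and f: "\<And>t. t \<in> space (lebesgue_vec J) \<Longrightarrow> 0 \<le> f t"
    and h: "h \<in> borel_measurable (real_vec J)" "\<And>x. 0 \<le> h x"
    and tiltable: "tiltable P h (\<lambda>\<omega>. \<lambda>j\<in>J. V \<omega> j + s j)"
    and T: "tilted_vector P h (\<lambda>\<omega>. \<lambda>j\<in>J. V \<omega> j + s j) (real_vec J) Q T"
  shows "distributed Q (lebesgue_vec J) T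
    (\<lambda>t. ennreal (h t * f (\<lambda>j\<in>J. t j - s j) / (\<integral>\<omega>. h (\<lambda>j\<in>J. V \<omega> j + s j) \<partial>P)))"
proof -
  interpret Q: prob_space Q by fact
  define L where "L = lebesgue_vec J"
  define X where "X = (\<lambda>\<omega>. \<lambda>j\<in>J. V \<omega> j + s j)"
  define K where "K = (\<integral>\<omega>. h (X \<omega>) \<partial>P)"
  define g where "g = (\<lambda>t. ennreal (h t * f (\<lambda>j\<in>J. t j - s j) / K))"
  have sets_L: "sets L = sets (real_vec J)"
    unfolding L_def by (rule sets_PiM_cong) auto
  have space_L: "space L = J \<rightarrow>\<^sub>E UNIV" by (simp add: L_def space_PiM)
  have int: "integrable P (\<lambda>\<omega>. h (X \<omega>))" and K: "0 < K"
    using tiltable by (simp_all add: tiltable_def K_def X_def)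
  have T': "T \<in> measurable Q L"
    using T sets_L by (simp add: tilted_vector_def cong: measurable_cong_sets)
  have V: "V \<in> measurable P L"
    using dens by (simp add: distributed_def L_def)
  have plus: "(\<lambda>x. \<lambda>j\<in>J. x j + s j) \<in> measurable L L"
    and minus: "(\<lambda>t. \<lambda>j\<in>J. t j - s j) \<in> measurable L L"
    unfolding L_def by measurable
  have X: "X \<in> measurable P L"
    unfolding X_def by (rule measurable_compose[OF V plus])
  have hL: "h \<in> borel_measurable L"
    using h(1) sets_L by (simp cong: measurable_cong_sets)
  have fL: "(\<lambda>t. ennreal (f t)) \<in> borel_measurable L"
    using dens by (simp add: distributed_def L_def)
  have g_eq: "g t = ennreal (f (\<lambda>j\<in>J. t j - s j)) * ennreal (h t) / ennreal K" for t
  proof -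
    \<comment> \<open>Nonnegativity of \<open>f\<close> is assumed on the product space only; the
      restricted function lies there whatever \<open>t\<close> is.\<close>
    have "0 \<le> f (\<lambda>j\<in>J. t j - s j)"
      by (rule f) (simp add: space_PiM)
    then show ?thesis
      using K h(2) by (simp add: g_def ennreal_mult divide_ennreal[symmetric] mult.commute)
  qed
  have g: "g \<in> borel_measurable L"
    unfolding g_eq[abs_def] using measurable_compose[OF minus fL] hL by simp
  have "distr Q L T = density L g"
  proof (rule measure_eqI)
    fix B assume "B \<in> sets (distr Q L T)"
    then have B: "B \<in> sets L" by simp
    have ind: "(\<lambda>\<omega>. indicator B (X \<omega>) :: real) \<in> borel_measurable P"
      using X B by measurable
    \<comment> \<open>Domination by \<open>h (X \<omega>)\<close>. Integrability allows the passage
      to the extended integral, where the density of \<open>V\<close> can be inserted.\<close>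
    have intB: "integrable P (\<lambda>\<omega>. indicator B (X \<omega>) * h (X \<omega>))"
      by (rule Bochner_Integration.integrable_bound[OF int])
         (use ind int h(2) in \<open>auto simp: indicator_def\<close>)
    have "emeasure (distr Q L T) B = ennreal (measure Q {\<omega> \<in> space Q. T \<omega> \<in> B})"
      using T' B by (simp add: emeasure_distr Q.emeasure_eq_measure vimage_def Int_def conj_commute)
    also have "\<dots> = ennreal ((\<integral>\<omega>. indicator B (X \<omega>) * h (X \<omega>) \<partial>P) / K)"
      using T B sets_L by (simp add: tilted_vector_def X_def K_def)
    also have "\<dots> = ennreal (\<integral>\<omega>. indicator B (X \<omega>) * h (X \<omega>) \<partial>P) / ennreal K"
      using K h(2) by (intro divide_ennreal[symmetric]) auto
    also have "ennreal (\<integral>\<omega>. indicator B (X \<omega>) * h (X \<omega>) \<partial>P)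
        = (\<integral>\<^sup>+\<omega>. ennreal (indicator B (X \<omega>) * h (X \<omega>)) \<partial>P)"
      using intB h(2) by (intro nn_integral_eq_integral[symmetric]) auto
    also have "\<dots> = (\<integral>\<^sup>+x. ennreal (f x) *
        ennreal (indicator B (\<lambda>j\<in>J. x j + s j) * h (\<lambda>j\<in>J. x j + s j)) \<partial>L)"
      unfolding X_def
    proof (rule distributed_nn_integral[OF dens[folded L_def], symmetric])
      have "(\<lambda>x. ennreal (indicator B x * h x)) \<in> borel_measurable L"
        using B hL by measurable
      from measurable_compose[OF plus this]
      show "(\<lambda>x. ennreal (indicator B (\<lambda>j\<in>J. x j + s j) * h (\<lambda>j\<in>J. x j + s j))) \<in> borel_measurable L" .
    qed
    also have "\<dots> = (\<integral>\<^sup>+t. ennreal (f (\<lambda>j\<in>J. t j - s j)) * ennreal (indicator B t * h t) \<partial>L)"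
      unfolding L_def
    proof (rule nn_integral_lebesgue_vec_shift[OF J])
      show "(\<lambda>t. ennreal (indicator B t * h t)) \<in> borel_measurable (real_vec J)"
        using B h(1) sets_L by measurable
    qed (use fL in \<open>simp add: L_def\<close>)
    also have "\<dots> / ennreal K =
        (\<integral>\<^sup>+t. ennreal (f (\<lambda>j\<in>J. t j - s j)) * ennreal (indicator B t * h t) / ennreal K \<partial>L)"
    proof (rule nn_integral_divide[symmetric])
      have "(\<lambda>t. ennreal (indicator B t * h t)) \<in> borel_measurable L"
        using B hL by measurable
      with measurable_compose[OF minus fL]
      show "(\<lambda>t. ennreal (f (\<lambda>j\<in>J. t j - s j)) * ennreal (indicator B t * h t)) \<in> borel_measurable L"
        by (rule borel_measurable_times_ennreal)
    qed
    also have "\<dots> = (\<integral>\<^sup>+t. g t * indicator B t \<partial>L)"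
      by (intro nn_integral_cong) (auto simp: g_eq indicator_def)
    also have "\<dots> = emeasure (density L g) B"
      by (rule emeasure_density[OF g B, symmetric])
    finally show "emeasure (distr Q L T) B = emeasure (density L g) B" .
  qed simp
  then show ?thesis
    using T' g by (simp add: distributed_def L_def g_def K_def X_def)
qed

section \<open>Total tilted mass of a component\<close>

text \<open>The exponential commutes with the maximum and turns the shift
  \<open>ln (a j / c)\<close> into the factor \<open>a j / c\<close>. What remains is the generator
  identity at \<open>a\<close>, divided by \<open>c\<close>.\<close>

lemma generator_exp_max:
  assumes gen: "generator P J l V" and J: "finite J" "J \<noteq> {}"
    and a: "\<And>j. j \<in> J \<Longrightarrow> 0 < a j" and c: "0 < c"
  shows "integrable P (\<lambda>\<omega>. exp_max J (\<lambda>j\<in>J. V \<omega> j + ln (a j / c)))"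
    and "(\<integral>\<omega>. exp_max J (\<lambda>j\<in>J. V \<omega> j + ln (a j / c)) \<partial>P) = l (\<lambda>j\<in>J. a j) / c"
    and "0 < l (\<lambda>j\<in>J. a j)"
proof -
  define Y where "Y = (\<lambda>\<omega>. Max ((\<lambda>j. a j * exp (V \<omega> j)) ` J))"
  have one: "(\<integral>\<omega>. exp (V \<omega> j) \<partial>P) = 1" if "j \<in> J" for j
    using gen that by (simp add: generator_def)
  \<comment> \<open>A non-integrable function has integral 0 by default, so the value 1 forces
    integrability.\<close>
  have int: "integrable P (\<lambda>\<omega>. exp (V \<omega> j))" if "j \<in> J" for j
    using one[OF that] not_integrable_integral_eq[of P "\<lambda>\<omega>. exp (V \<omega> j)"] by auto
  have Vj [measurable]: "(\<lambda>\<omega>. V \<omega> j) \<in> borel_measurable P" if "j \<in> J" for j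
    using gen that by (auto simp: generator_def intro: measurable_component_singleton[THEN measurable_compose[rotated]])
  have meas: "Y \<in> borel_measurable P"
    unfolding Y_def using J by (intro borel_measurable_Max) measurable
  have lower: "a j * exp (V \<omega> j) \<le> Y \<omega>" if "j \<in> J" for j \<omega>
    unfolding Y_def using that J by (intro Max_ge) auto
  have nonneg: "0 \<le> Y \<omega>" for \<omega>
    using J lower a by (meson all_not_in_conv less_le_trans less_imp_le mult_pos_pos exp_gt_zero)
  \<comment> \<open>The terms are nonnegative, so their sum bounds the maximum and serves as an
    integrable majorant of \<open>Y\<close>.\<close>
  have upper: "Y \<omega> \<le> (\<Sum>j\<in>J. a j * exp (V \<omega> j))" for \<omega>
    unfolding Y_def using J a
    by (subst Max_le_iff) (auto intro!: member_le_sum simp: less_imp_le)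
  have intY: "integrable P Y"
    by (rule Bochner_Integration.integrable_bound[of P "\<lambda>\<omega>. \<Sum>j\<in>J. a j * exp (V \<omega> j)"])
       (use int meas nonneg upper in \<open>auto intro!: AE_I2 order_trans[OF _ abs_ge_self]\<close>)
  have l_eq: "(\<integral>\<omega>. Y \<omega> \<partial>P) = l (\<lambda>j\<in>J. a j)"
  proof -
    have "(\<lambda>j\<in>J. a j) \<in> J \<rightarrow>\<^sub>E {0..}" using a by (auto simp: less_imp_le)
    then have "(\<integral>\<omega>. Max ((\<lambda>j. (\<lambda>j\<in>J. a j) j * exp (V \<omega> j)) ` J) \<partial>P) = l (\<lambda>j\<in>J. a j)"
      using gen unfolding generator_def by blast
    moreover have "Y \<omega> = Max ((\<lambda>j. (\<lambda>j\<in>J. a j) j * exp (V \<omega> j)) ` J)" for \<omega>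
      unfolding Y_def by (intro arg_cong[of _ _ Max] image_cong) auto
    ultimately show ?thesis by (simp only:)
  qed
  obtain j where j: "j \<in> J" using J by auto
  \<comment> \<open>A single coordinate already bounds the mean of the maximum below by a positive
    number.\<close>
  have "a j = (\<integral>\<omega>. a j * exp (V \<omega> j) \<partial>P)" using one[OF j] by simp
  also have "\<dots> \<le> (\<integral>\<omega>. Y \<omega> \<partial>P)"
    by (intro integral_mono intY integrable_mult_right int j lower)
  finally show "0 < l (\<lambda>j\<in>J. a j)" using a[OF j] l_eq by simp
  have eq: "exp_max J (\<lambda>j\<in>J. V \<omega> j + ln (a j / c)) = Y \<omega> / c" for \<omega>
  proof -
    have "exp_max J (\<lambda>j\<in>J. V \<omega> j + ln (a j / c))
        = Max ((\<lambda>j. exp ((\<lambda>j\<in>J. V \<omega> j + ln (a j / c)) j)) ` J)"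
      unfolding exp_max_def by (rule exp_Max[OF J])
    also have "(\<lambda>j. exp ((\<lambda>j\<in>J. V \<omega> j + ln (a j / c)) j)) ` J = (\<lambda>j. a j * exp (V \<omega> j) / c) ` J"
      using a c by (intro image_cong) (auto simp: exp_add)
    also have "Max \<dots> = Y \<omega> / c"
      using mono_Max_commute[of "\<lambda>y. y / c" "(\<lambda>j. a j * exp (V \<omega> j)) ` J"] c J
      by (simp add: Y_def mono_def divide_right_mono image_image)
    finally show ?thesis .
  qed
  show "integrable P (\<lambda>\<omega>. exp_max J (\<lambda>j\<in>J. V \<omega> j + ln (a j / c)))"
    unfolding eq using intY by simp
  show "(\<integral>\<omega>. exp_max J (\<lambda>j\<in>J. V \<omega> j + ln (a j / c)) \<partial>P) = l (\<lambda>j\<in>J. a j) / c"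
    unfolding eq using l_eq by simp
qed

section \<open>The stdf of the mixture at the vector of ones\<close>

text \<open>The mixture is at most one in all coordinates iff each factor satisfies its own bounds,
  so independence makes the distribution function a product and \<open>- ln\<close> makes it a sum.
  The hypothesis \<open>pos\<close> excludes vanishing factors, at which the logarithm would not
  split.\<close>

lemma mixture_stdf_ones:
  assumes P: "prob_space P" and mix: "mixture_model P d r A Z" and r: "0 < r"
    and pos: "\<And>k. k \<in> {1..r} \<Longrightarrow> 0 < factor_stdf P d A Z k (\<lambda>j\<in>signature d A k. A j k)"
  shows "mixture_stdf P d r A Z (\<lambda>j\<in>{1..d}. 1)
    = (\<Sum>k\<in>{1..r}. factor_stdf P d A Z k (\<lambda>j\<in>signature d A k. A j k))"
proof -
  interpret prob_space P by fact
  let ?D = "{1..d}" and ?R = "{1..r}"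
  let ?N = "real_vec ?D"
  \<comment> \<open>In \<open>ereal\<close>, \<open>1 / 0 = \<infinity>\<close>: coordinates outside
    the signature impose no bound.\<close>
  define b where "b = (\<lambda>k j. 1 / ereal (if j \<in> signature d A k then A j k else 0))"
  define S where "S = (\<lambda>k. {z \<in> space ?N. \<forall>j\<in>?D. ereal (z j) \<le> b k j})"
  define p where "p = (\<lambda>k. prob (Z k -` S k \<inter> space P))"
  have indep: "indep_vars (\<lambda>_. ?N) Z ?R" and A: "\<And>j k. j \<in> ?D \<Longrightarrow> k \<in> ?R \<Longrightarrow> 0 \<le> A j k"
    using mix by (auto simp: mixture_model_def)
  have Z: "Z k \<in> measurable P ?N" if "k \<in> ?R" for k
    using indep that by (auto simp: indep_vars_def2)
  have Zj: "(\<lambda>\<omega>. Z k \<omega> j) \<in> borel_measurable P" if "k \<in> ?R" "j \<in> ?D" for k j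
    using measurable_compose[OF Z[OF that(1)] measurable_component_singleton[OF that(2)]] .
  have M: "mixture_vector d r A Z \<in> measurable P ?N"
    unfolding mixture_vector_def
    by (intro measurable_restrict borel_measurable_Max borel_measurable_times) (use Zj in auto)
  have box: "{z \<in> space ?N. \<forall>j\<in>?D. ereal (z j) \<le> y j} \<in> sets ?N" for y :: "nat \<Rightarrow> ereal"
    by measurable
  then have S: "S k \<in> sets ?N" for k by (simp add: S_def)
  have factor: "factor_stdf P d A Z k (\<lambda>j\<in>signature d A k. A j k) = - ln (p k)" if "k \<in> ?R" for k
  proof -
    have "{z \<in> space ?N. \<forall>j\<in>?D. ereal (z j) \<le> 1 / ereal ((\<lambda>j\<in>?D.
        if j \<in> signature d A k then (\<lambda>j\<in>signature d A k. A j k) j else 0) j)} = S k"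
      by (auto simp: S_def b_def)
    then show ?thesis
      using measure_distr[OF Z[OF that] S[of k]]
      by (simp add: factor_stdf_def stdf_def joint_cdf_def p_def del: restrict_apply)
  qed
  \<comment> \<open>A vanishing cdf would give the stdf the junk value \<^term>\<open>- ln 0 = 0\<close>.\<close>
  have p: "0 < p k" if "k \<in> ?R" for k
  proof -
    have "p k \<noteq> 0" using pos[OF that] factor[OF that] by auto
    then show ?thesis by (simp add: p_def zero_less_measure_iff)
  qed
  \<comment> \<open>If \<open>A j k = 0\<close>, the left side reads \<open>0 \<le> 1\<close> and
    the right bound is \<open>\<infinity>\<close>, so both hold; otherwise divide by
    \<open>A j k\<close>.\<close>
  have *: "ereal (A j k * z) \<le> 1 \<longleftrightarrow> ereal z \<le> b k j" if "j \<in> ?D" "k \<in> ?R" for j k z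
  proof (cases "A j k = 0")
    case True
    then show ?thesis by (simp add: b_def signature_def zero_ereal_def[symmetric] divide_ereal_def)
  next
    case False
    then have "0 < A j k" using A[OF that] by simp
    then show ?thesis
      using that by (simp add: b_def signature_def one_ereal_def divide_ereal_def pos_le_divide_eq field_simps)
  qed
  let ?M = "mixture_vector d r A Z"
  have "ereal (?M \<omega> j) \<le> 1 \<longleftrightarrow> (\<forall>k\<in>?R. ereal (Z k \<omega> j) \<le> b k j)" if "j \<in> ?D" for j \<omega>
  proof -
    have "?M \<omega> j \<le> 1 \<longleftrightarrow> (\<forall>k\<in>?R. A j k * Z k \<omega> j \<le> 1)"
      using r that by (simp add: mixture_vector_def)
    then show ?thesis using *[OF that] by (simp add: one_ereal_def)
  qed
  then have "?M -` {z \<in> space ?N. \<forall>j\<in>?D. ereal (z j) \<le> 1} \<inter> space P = (\<Inter>k\<in>?R. Z k -` S k \<inter> space P)"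
    using r measurable_space[OF M] measurable_space[OF Z] by (fastforce simp: S_def)
  then have "measure (distr P ?N ?M) {z \<in> space ?N. \<forall>j\<in>?D. ereal (z j) \<le> 1}
      = prob (\<Inter>k\<in>?R. Z k -` S k \<inter> space P)"
    using measure_distr[OF M box[of "\<lambda>_. 1"]] by simp
  also have "\<dots> = (\<Prod>k\<in>?R. p k)"
    unfolding p_def by (rule indep_varsD[OF indep]) (use r S in auto)
  finally have cdf: "measure (distr P ?N ?M) {z \<in> space ?N. \<forall>j\<in>?D. ereal (z j) \<le> 1} = (\<Prod>k\<in>?R. p k)" .
  have "{z \<in> space ?N. \<forall>j\<in>?D. ereal (z j) \<le> 1 / ereal ((\<lambda>j\<in>?D. 1) j)}
      = {z \<in> space ?N. \<forall>j\<in>?D. ereal (z j) \<le> 1}"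
    by (auto simp: one_ereal_def[symmetric] divide_ereal_def)
  with cdf have "mixture_stdf P d r A Z (\<lambda>j\<in>?D. 1) = - ln (\<Prod>k\<in>?R. p k)"
    by (simp add: mixture_stdf_def stdf_def joint_cdf_def del: restrict_apply)
  also have "\<dots> = (\<Sum>k\<in>?R. - ln (p k))"
    using p ln_prod[of ?R p] by (force simp: sum_negf)
  finally show ?thesis by (simp add: factor)
qed

section \<open>The tilted mixture law and the component densities\<close>

theorem proposition5p1:
  fixes P :: "'a measure" and Q :: "'b measure"
    and d r :: nat and A :: "nat \<Rightarrow> nat \<Rightarrow> real" and m :: "nat \<Rightarrow> real"
    and Z V :: "nat \<Rightarrow> 'a \<Rightarrow> nat \<Rightarrow> real" and U :: "'a \<Rightarrow> nat \<Rightarrow> ereal"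
    and J :: "nat \<Rightarrow> nat set" and l :: "(nat \<Rightarrow> real) \<Rightarrow> real"
    and lf :: "nat \<Rightarrow> (nat \<Rightarrow> real) \<Rightarrow> real"
    and PV :: "nat \<Rightarrow> 'a \<Rightarrow> nat \<Rightarrow> real" and w c :: "nat \<Rightarrow> real"
    and g :: "nat \<Rightarrow> (nat \<Rightarrow> real) \<Rightarrow> real" and n :: "nat \<Rightarrow> nat \<Rightarrow> real"
    and q :: "((nat \<Rightarrow> real) \<Rightarrow> real) \<Rightarrow> nat \<Rightarrow> nat \<Rightarrow> (nat \<Rightarrow> real) \<Rightarrow> real"
  defines "J \<equiv> signature d A"
    and "l \<equiv> mixture_stdf P d r A Z"
    and "lf \<equiv> factor_stdf P d A Z"
    and "PV \<equiv> shifted_generator d A m V"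
    and "w \<equiv> \<lambda>k. lf k (\<lambda>j\<in>J k. A j k) / l (\<lambda>j\<in>{1..d}. 1)"
    and "g \<equiv> \<lambda>k t. exp_max (J k) t / (\<Sum>j\<in>J k. exp (t j))"
    and "c \<equiv> \<lambda>k. (\<Sum>j\<in>J k. A j k) / lf k (\<lambda>j\<in>J k. A j k)"
    and "n \<equiv> \<lambda>j k. A j k / (\<Sum>i\<in>J k. A i k)"
    and "q \<equiv> \<lambda>f j k t. exp (t j) * f (\<lambda>i\<in>J k. t i - log_shift d A m k i) / (A j k / m k)"
  assumes "prob_space P"
    and "mixture_model P d r A Z"
    and "\<forall>k\<in>{1..r}. generator P (J k) (lf k) (V k)"
    and "mass_vector r m"
    and "mixture_generator P d r A m V U"
  shows "tiltable P (exp_max_ext {1..d}) U \<and>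
    (\<forall>k\<in>{1..r}. tiltable P (exp_max (J k)) (PV k)) \<and>
    (\<forall>T Tf. prob_space Q \<longrightarrow>
       tilted_vector P (exp_max_ext {1..d}) U (ext_vec {1..d}) Q T \<longrightarrow>
       (\<forall>k\<in>{1..r}. tilted_vector P (exp_max (J k)) (PV k) (real_vec (J k)) Q (Tf k)) \<longrightarrow>
         (\<forall>B \<in> sets (ext_vec {1..d}).
            measure Q {\<omega> \<in> space Q. T \<omega> \<in> B} =
              (\<Sum>k\<in>{1..r}. w k * measure Q {\<omega> \<in> space Q.
                 Tf k \<omega> \<in> face_proj (J k) ` (face {1..d} (J k) \<inter> B)})) \<and>
         (\<forall>k\<in>{1..r}. \<forall>f :: (nat \<Rightarrow> real) \<Rightarrow> real.
            (\<forall>t \<in> space (lebesgue_vec (J k)). 0 \<le> f t) \<longrightarrow>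
            distributed P (lebesgue_vec (J k)) (V k) (\<lambda>t. ennreal (f t)) \<longrightarrow>
            distributed Q (lebesgue_vec (J k)) (Tf k)
              (\<lambda>t. ennreal (c k * g k t * (\<Sum>j\<in>J k. n j k * q f j k t)))))"
proof -
  interpret prob_space P by fact
  let ?D = "{1..d}" and ?R = "{1..r}"
  let ?N = "ext_vec ?D"
  \<comment> \<open>Keeps the simplifier from turning \<open>{1..d}\<close> into
    \<open>{Suc 0..d}\<close>.\<close>
  note One_nat_def [simp del]
  define a where "a = (\<lambda>k. lf k (\<lambda>j\<in>J k. A j k))"
  have m: "0 < m k" if "k \<in> ?R" for k
    using \<open>mass_vector r m\<close> that by (auto simp: mass_vector_def)
  \<comment> \<open>For \<open>r = 0\<close> the masses would sum to 0 instead of 1.\<close>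
  have r: "0 < r"
    using \<open>mass_vector r m\<close> by (cases "r = 0") (auto simp: mass_vector_def)
  have JD: "J k \<subseteq> ?D" and finJ: "finite (J k)" and Apos: "\<And>j. j \<in> J k \<Longrightarrow> 0 < A j k" for k
    by (auto simp: J_def signature_def)
  \<comment> \<open>A positive column sum requires a positive entry.\<close>
  have neJ: "J k \<noteq> {}" if "k \<in> ?R" for k
  proof
    assume "J k = {}"
    then have "(\<Sum>j\<in>?D. A j k) \<le> 0"
      by (intro sum_nonpos) (force simp: J_def signature_def)
    moreover have "0 < (\<Sum>j\<in>?D. A j k)"
      using \<open>mixture_model P d r A Z\<close> that unfolding mixture_model_def by blast
    ultimately show False by simp
  qed
  \<comment> \<open>The form with \<open>log_shift\<close> matches the density formula, the one with
    \<open>ln\<close> matches \<open>generator_exp_max\<close>.\<close>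
  have PV_eq: "PV k = (\<lambda>\<omega>. \<lambda>j\<in>J k. V k \<omega> j + log_shift d A m k j)"
    and PV_ln: "PV k = (\<lambda>\<omega>. \<lambda>j\<in>J k. V k \<omega> j + ln (A j k / m k))" for k
    by (auto simp: PV_def shifted_generator_def J_def log_shift_def fun_eq_iff)
  have PV: "PV k \<in> measurable P (real_vec (J k))" if "k \<in> ?R" for k
  proof -
    have V: "V k \<in> measurable P (real_vec (J k))"
      using assms that by (simp add: generator_def)
    then have "(\<lambda>\<omega>. V k \<omega> j) \<in> borel_measurable P" if "j \<in> J k" for j
      using that by (rule measurable_compose[OF _ measurable_component_singleton])
    then show ?thesis
      unfolding PV_eq by (intro measurable_restrict borel_measurable_add) auto
  qed
  have int: "integrable P (\<lambda>\<omega>. exp_max (J k) (PV k \<omega>))"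
    and integral: "(\<integral>\<omega>. exp_max (J k) (PV k \<omega>) \<partial>P) = a k / m k"
    and apos: "0 < a k" if "k \<in> ?R" for k
  proof -
    have "generator P (J k) (lf k) (V k)" using assms that by simp
    note * = generator_exp_max[OF this finJ neJ[OF that], where a = "\<lambda>j. A j k", OF Apos m[OF that]]
    show "integrable P (\<lambda>\<omega>. exp_max (J k) (PV k \<omega>))"
      and "(\<integral>\<omega>. exp_max (J k) (PV k \<omega>) \<partial>P) = a k / m k" and "0 < a k"
      unfolding PV_ln a_def by (rule *; assumption)+
  qed
  have tilt: "tiltable P (exp_max (J k)) (PV k)" if "k \<in> ?R" for k
    using that m int integral apos by (simp add: tiltable_def)
  have l1: "l (\<lambda>j\<in>?D. 1) = (\<Sum>k\<in>?R. a k)"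
    using mixture_stdf_ones[OF \<open>prob_space P\<close> \<open>mixture_model P d r A Z\<close> r] apos
    by (simp add: l_def a_def lf_def J_def)
  have l1_pos: "0 < l (\<lambda>j\<in>?D. 1)"
    unfolding l1 using r apos by (intro sum_pos) auto

  \<comment> \<open>The components as random vectors in the extended space: the law of
    \<open>U\<close> is the mixture of their laws.\<close>
  define Y where "Y = (\<lambda>k \<omega>. ext_embed ?D (J k) (PV k \<omega>))"
  have Y: "Y k \<in> measurable P ?N" if "k \<in> ?R" for k
    unfolding Y_def by (rule measurable_compose[OF PV[OF that] measurable_ext_embed])
  have U: "U \<in> measurable P ?N"
    using assms by (simp add: mixture_generator_def)
  have face_iff: "PV k \<omega> \<in> face_proj (J k) ` (face ?D (J k) \<inter> B) \<longleftrightarrow> Y k \<omega> \<in> B" for k \<omega> B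
    unfolding face_proj_image[OF JD] Y_def PV_eq by simp
  have law: "emeasure (distr P ?N U) B = (\<Sum>k\<in>?R. ennreal (m k) * emeasure (distr P ?N (Y k)) B)"
    if B: "B \<in> sets ?N" for B
  proof -
    have "emeasure (distr P ?N U) B = ennreal (measure P {\<omega> \<in> space P. U \<omega> \<in> B})"
      using U B by (simp add: emeasure_distr emeasure_eq_measure vimage_def Int_def conj_commute)
    also have "\<dots> = ennreal (\<Sum>k\<in>?R. m k * measure P {\<omega> \<in> space P. Y k \<omega> \<in> B})"
      using \<open>mixture_generator P d r A m V U\<close> B face_iff
      by (simp add: mixture_generator_def J_def PV_def)
    also have "\<dots> = (\<Sum>k\<in>?R. ennreal (m k) * ennreal (measure P {\<omega> \<in> space P. Y k \<omega> \<in> B}))"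
      using m by (subst sum_ennreal[symmetric]) (auto simp: ennreal_mult less_imp_le intro!: sum.cong)
    also have "\<dots> = (\<Sum>k\<in>?R. ennreal (m k) * emeasure (distr P ?N (Y k)) B)"
      using Y B by (intro sum.cong)
        (simp_all add: emeasure_distr emeasure_eq_measure vimage_def Int_def conj_commute)
    finally show ?thesis .
  qed
  have exp_Y: "exp_max_ext ?D (Y k \<omega>) = exp_max (J k) (PV k \<omega>)" if "k \<in> ?R" for k \<omega>
    unfolding Y_def using JD neJ[OF that] by (intro exp_max_ext_embed) auto
  have E_nonneg: "0 \<le> exp_max_ext ?D x" for x
    by (simp add: exp_max_ext_def exp_ext_def)
  have E_meas: "exp_max_ext ?D \<in> borel_measurable ?N"
    by (rule measurable_exp_max_ext) simp
  have intB: "integrable P (\<lambda>\<omega>. indicator B (Y k \<omega>) * exp_max_ext ?D (Y k \<omega>))"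
    if "k \<in> ?R" and B: "B \<in> sets ?N" for k B
  proof (rule Bochner_Integration.integrable_bound[OF int[OF that(1)]])
    show "(\<lambda>\<omega>. indicator B (Y k \<omega>) * exp_max_ext ?D (Y k \<omega>)) \<in> borel_measurable P"
      using Y[OF that(1)] E_meas B by measurable
  qed (simp add: exp_Y[OF that(1)] indicator_def exp_max_def)
  have mixture: "(\<integral>\<omega>. indicator B (U \<omega>) * exp_max_ext ?D (U \<omega>) \<partial>P)
      = (\<Sum>k\<in>?R. m k * (\<integral>\<omega>. indicator B (Y k \<omega>) * exp_max (J k) (PV k \<omega>) \<partial>P))"
    if B: "B \<in> sets ?N" for B
  proof -
    have "(\<lambda>x. indicator B x * exp_max_ext ?D x) \<in> borel_measurable ?N"
      using E_meas B by measurable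
    from integral_mixture(2)[OF U Y law this] intB[OF _ B] m E_nonneg
    show ?thesis by (simp add: exp_Y less_imp_le)
  qed
  have intU: "integrable P (\<lambda>\<omega>. exp_max_ext ?D (U \<omega>))"
    and totalU: "(\<integral>\<omega>. exp_max_ext ?D (U \<omega>) \<partial>P) = (\<Sum>k\<in>?R. m k * (\<integral>\<omega>. exp_max_ext ?D (Y k \<omega>) \<partial>P))"
    using integral_mixture[OF U Y law E_meas E_nonneg] int m by (simp_all add: exp_Y less_imp_le)
  \<comment> \<open>The masses cancel: \<open>m k * (a k / m k) = a k\<close>.\<close>
  have total: "(\<integral>\<omega>. exp_max_ext ?D (U \<omega>) \<partial>P) = l (\<lambda>j\<in>?D. 1)"
    unfolding totalU l1 using m by (intro sum.cong) (force simp: exp_Y integral)+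
  have tiltU: "tiltable P (exp_max_ext ?D) U"
    using intU total l1_pos by (simp add: tiltable_def)

  have law_T: "measure Q {\<omega> \<in> space Q. T \<omega> \<in> B} =
      (\<Sum>k\<in>?R. w k * measure Q {\<omega> \<in> space Q. Tf k \<omega> \<in> face_proj (J k) ` (face ?D (J k) \<inter> B)})"
    if T: "tilted_vector P (exp_max_ext ?D) U ?N Q T"
      and Tf: "\<forall>k\<in>?R. tilted_vector P (exp_max (J k)) (PV k) (real_vec (J k)) Q (Tf k)"
      and B: "B \<in> sets ?N" for T Tf B
  proof -
    define I where "I = (\<lambda>k. \<integral>\<omega>. indicator B (Y k \<omega>) * exp_max (J k) (PV k \<omega>) \<partial>P)"
    have Tk: "measure Q {\<omega> \<in> space Q. Tf k \<omega> \<in> face_proj (J k) ` (face ?D (J k) \<inter> B)} = I k / (a k / m k)"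
      if k: "k \<in> ?R" for k
    proof -
      let ?C = "face_proj (J k) ` (face ?D (J k) \<inter> B)"
      \<comment> \<open>The tilted law of \<open>Tf k\<close> is given on measurable sets only,
        hence the detour through a preimage.\<close>
      have "?C = ext_embed ?D (J k) -` B \<inter> space (real_vec (J k))"
        unfolding face_proj_image[OF JD] by (auto simp: space_PiM)
      then have "?C \<in> sets (real_vec (J k))"
        using measurable_sets[OF measurable_ext_embed B] by simp
      moreover have "indicator ?C (PV k \<omega>) = (indicator B (Y k \<omega>) :: real)" for \<omega>
        using face_iff by (simp add: indicator_def)
      ultimately show ?thesis
        using Tf k integral[OF k] by (simp add: tilted_vector_def I_def)
    qed
    have "measure Q {\<omega> \<in> space Q. T \<omega> \<in> B} = (\<Sum>k\<in>?R. m k * I k) / l (\<lambda>j\<in>?D. 1)"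
      using T B mixture[OF B] total by (simp add: tilted_vector_def I_def)
    \<comment> \<open>Here the weight emerges: \<open>m k * I k\<close> is \<open>a k\<close> times
      the normalised term \<open>I k / (a k / m k)\<close>.\<close>
    also have "\<dots> = (\<Sum>k\<in>?R. w k * (I k / (a k / m k)))"
      unfolding sum_divide_distrib
    proof (rule sum.cong)
      fix k assume "k \<in> ?R"
      moreover have "w k = a k / l (\<lambda>j\<in>?D. 1)" by (simp only: w_def a_def)
      ultimately show "m k * I k / l (\<lambda>j\<in>?D. 1) = w k * (I k / (a k / m k))"
        using m[of k] apos[of k] by simp
    qed simp
    finally show ?thesis using Tk by simp
  qed

  have dens_T: "distributed Q (lebesgue_vec (J k)) (Tf k)
      (\<lambda>t. ennreal (c k * g k t * (\<Sum>j\<in>J k. n j k * q f j k t)))"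
    if Q: "prob_space Q"
      and Tf: "tilted_vector P (exp_max (J k)) (PV k) (real_vec (J k)) Q (Tf k)"
      and k: "k \<in> ?R" and f: "\<forall>t \<in> space (lebesgue_vec (J k)). 0 \<le> f t"
      and V: "distributed P (lebesgue_vec (J k)) (V k) (\<lambda>t. ennreal (f t))" for Tf k f
  proof -
    have "distributed Q (lebesgue_vec (J k)) (Tf k) (\<lambda>t. ennreal (exp_max (J k) t *
        f (\<lambda>j\<in>J k. t j - log_shift d A m k j) / (\<integral>\<omega>. exp_max (J k) (PV k \<omega>) \<partial>P)))"
      unfolding PV_eq
      by (rule distributed_tilted[OF Q finJ V])
         (use f measurable_exp_max[OF finJ] tilt[OF k] Tf exp_max_nonneg in \<open>auto simp: PV_eq\<close>)
    moreover have "exp_max (J k) t * f (\<lambda>j\<in>J k. t j - log_shift d A m k j) /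
        (\<integral>\<omega>. exp_max (J k) (PV k \<omega>) \<partial>P) = c k * g k t * (\<Sum>j\<in>J k. n j k * q f j k t)" for t
    proof -
      define F where "F = f (\<lambda>j\<in>J k. t j - log_shift d A m k j)"
      define Sa where "Sa = (\<Sum>j\<in>J k. A j k)"
      define Se where "Se = (\<Sum>j\<in>J k. exp (t j))"
      have Sa: "0 < Sa" unfolding Sa_def using finJ neJ[OF k] Apos by (intro sum_pos) auto
      have Se: "0 < Se" unfolding Se_def using finJ neJ[OF k] by (intro sum_pos) auto
      \<comment> \<open>\<open>A j k\<close> cancels between \<open>n j k\<close> and
        \<open>q f j k t\<close>. The factor left beside \<open>exp (t j)\<close> does not depend on
        \<open>j\<close>, so the sum produces \<open>Se\<close>, the denominator of
        \<open>g k t\<close>.\<close>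
      have "n j k * q f j k t = exp (t j) * (m k * F / Sa)" if "j \<in> J k" for j
        using Apos[OF that] by (simp add: n_def q_def F_def Sa_def)
      then have "(\<Sum>j\<in>J k. n j k * q f j k t) = Se * (m k * F / Sa)"
        by (simp add: Se_def sum_distrib_right sum_divide_distrib)
      moreover have "c k = Sa / a k" "g k t = exp_max (J k) t / Se"
        by (simp_all add: c_def a_def Sa_def g_def Se_def)
      ultimately show ?thesis
        using Sa Se m[OF k] apos[OF k] by (simp add: integral[OF k] F_def[symmetric])
    qed
    ultimately show ?thesis by simp
  qed
  show ?thesis
    using tiltU tilt law_T dens_T by blast
qed

end
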